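(* For every $n \geq 1$, the total number of occurrences of the pattern $231$ in all permutations in $\mathrm{Av}_n(123)$ is equal to the total number of occurrences of the pattern $231$ in all permutations in $\mathrm{Av}_n(132)$; that is, $f_{231}(\mathrm{Av}_n(123)) = f_{231}(\mathrm{Av}_n(132))$.
   Context: Permutations are written in one-line notation. For $p = p_1\cdots p_n \in S_n$ and $q = q_1 \cdots q_k\in S_k$, an occurrence of $q$ in $p$ (as a pattern) is a choice of indices $1 \le i_1 < \dots < i_k \le n$ such that $p_{i_1},\dots,p_{i_k}$ are in the same relative order as $q_1,\dots,q_k$ (i.e. $p_{i_s}<p_{i_t}$ iff $q_s<q_t$). $f_q(p)$ denotes the number of occurrences of $q$ in $p$, and $p$ avoids $q$ if $f_q(p)=0$. $\mathrm{Av}_n(r)$ is the set of permutations in $S_n$ avoiding $r$. For a finite set $\mathcal C$ of permutations, $f_q(\mathcal C)=\sum_{p\in\mathcal C} f_q(p)$. *)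

theory Defs
  imports "HOL-Combinatorics.Multiset_Permutations"
begin

text \<open>
  A permutation of \<open>{1..n}\<close> is given by its one-line notation: a list of length \<open>n\<close> in which
  each of \<open>1, \<dots>, n\<close> occurs exactly once. List positions are counted from \<open>0\<close>, so the
  indices of an occurrence range over \<open>{..<n}\<close>.
\<close>

definition Sym :: "nat \<Rightarrow> nat list set" where
  "Sym n = permutations_of_set {1..n}"

text \<open>An occurrence is the strictly increasing list of its indices.\<close>

definition occurrences :: "nat list \<Rightarrow> nat list \<Rightarrow> nat list set" where
  "occurrences q p =
     {is. length is = length q \<and> sorted_wrt (<) is \<and> set is \<subseteq> {..<length p} \<and>
          (\<forall>s<length q. \<forall>t<length q. p ! (is ! s) < p ! (is ! t) \<longleftrightarrow> q ! s < q ! t)}"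

lemma finite_occurrences: "finite (occurrences q p)"
proof (rule finite_subset)
  show "occurrences q p \<subseteq> {is. set is \<subseteq> {..<length p} \<and> length is = length q}"
    by (auto simp: occurrences_def)
  show "finite {is. set is \<subseteq> {..<length p} \<and> length is = length q}"
    by (rule finite_lists_length_eq) simp
qed

definition num_occ :: "nat list \<Rightarrow> nat list \<Rightarrow> nat" where
  "num_occ q p = card (occurrences q p)"

definition avoids :: "nat list \<Rightarrow> nat list \<Rightarrow> bool" where
  "avoids p r \<longleftrightarrow> num_occ r p = 0"

definition Av :: "nat \<Rightarrow> nat list \<Rightarrow> nat list set" where
  "Av n r = {p \<in> Sym n. avoids p r}"

lemma finite_Av: "finite (Av n r)"
  by (simp add: Av_def Sym_def)

definition total_occ :: "nat list \<Rightarrow> nat list set \<Rightarrow> nat" where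
  "total_occ q C = (\<Sum>p\<in>C. num_occ q p)"

end

theory Submission
  imports Defs "HOL-Computational_Algebra.Formal_Power_Series"
begin

text \<open>
  In a \<open>123\<close>-avoider only the left-to-right minima \<open>m\<close> start an ascent; write \<open>u(m)\<close> for the number
  of later larger entries. Then \<open>f\<^sub>1\<^sub>2 = \<Sum> u\<close> and \<open>2 f\<^sub>1\<^sub>3\<^sub>2 = \<Sum> u (u - 1)\<close>. Counting the ascents
  inside all triples gives \<open>(n - 2) f\<^sub>1\<^sub>2 = 2 f\<^sub>1\<^sub>3\<^sub>2 + 2 f\<^sub>2\<^sub>1\<^sub>3 + f\<^sub>2\<^sub>3\<^sub>1 + f\<^sub>3\<^sub>1\<^sub>2\<close>, and since reverse-complement
  preserves the class and exchanges \<open>132\<close> with \<open>213\<close> and \<open>231\<close> with \<open>312\<close>, the total of \<open>2 f\<^sub>2\<^sub>3\<^sub>1\<close> is the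
  total of \<open>\<Sum> u (n - 2 u)\<close>. The sequence of the \<open>u(m)\<close> has the same distribution over \<open>123\<close>- and over
  \<open>132\<close>-avoiders (in the spirit of Simion and Schmidt: every entry that is not a minimum is forced), so
  it remains to compare \<open>2 f\<^sub>2\<^sub>3\<^sub>1\<close> and \<open>\<Sum> u (n - 2 u)\<close> over \<open>132\<close>-avoiders. There the decomposition
  \<open>L N R\<close> at the maximum yields generating functions that are rational in \<open>t = X C\<close>, where \<open>C\<close> is the
  Catalan series.
\<close>

section \<open>Sums over pairs and triples of entries in list order\<close>

primrec pair_sum :: "('a \<Rightarrow> 'a \<Rightarrow> nat) \<Rightarrow> 'a list \<Rightarrow> nat" where
  "pair_sum w [] = 0"
| "pair_sum w (x # p) = sum_list (map (w x) p) + pair_sum w p"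

primrec triple_sum :: "('a \<Rightarrow> 'a \<Rightarrow> 'a \<Rightarrow> nat) \<Rightarrow> 'a list \<Rightarrow> nat" where
  "triple_sum w [] = 0"
| "triple_sum w (x # p) = pair_sum (w x) p + triple_sum w p"

lemma pair_sum_append:
  "pair_sum w (xs @ ys) = pair_sum w xs + pair_sum w ys + (\<Sum>x\<leftarrow>xs. sum_list (map (w x) ys))"
  by (induction xs) auto

lemma pair_sum_add: "pair_sum (\<lambda>x y. v x y + w x y) p = pair_sum v p + pair_sum w p"
  by (induction p) (auto simp: sum_list_addf)

lemma sum_list_swap:
  "(\<Sum>x\<leftarrow>xs. \<Sum>y\<leftarrow>ys. f x y) = (\<Sum>y\<leftarrow>ys. \<Sum>x\<leftarrow>xs. f x y :: nat)"
  by (induction xs) (auto simp: sum_list_addf)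

lemma triple_sum_append:
  "triple_sum w (xs @ ys) = triple_sum w xs + triple_sum w ys
     + (\<Sum>x\<leftarrow>xs. pair_sum (w x) ys) + (\<Sum>y\<leftarrow>ys. pair_sum (\<lambda>a b. w a b y) xs)"
proof (induction xs)
  case (Cons x xs)
  then show ?case
    using sum_list_swap[of "w x" ys xs] by (simp add: pair_sum_append sum_list_addf)
qed simp

lemma triple_sum_add:
  "triple_sum (\<lambda>x y z. v x y z + w x y z) p = triple_sum v p + triple_sum w p"
  by (induction p) (auto simp: pair_sum_add)

lemma pair_sum_cong:
  "(\<And>x y. x \<in> set p \<Longrightarrow> y \<in> set p \<Longrightarrow> v x y = w x y) \<Longrightarrow> pair_sum v p = pair_sum w p"
  by (induction p) (auto intro!: arg_cong[where f = sum_list])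

lemma triple_sum_cong:
  "(\<And>x y z. x \<in> set p \<Longrightarrow> y \<in> set p \<Longrightarrow> z \<in> set p \<Longrightarrow> v x y z = w x y z)
     \<Longrightarrow> triple_sum v p = triple_sum w p"
  by (induction p) (auto intro!: pair_sum_cong arg_cong2[where f = "(+)"])

lemma triple_sum_cong_distinct:
  assumes "distinct p"
    and "\<And>x y z. x \<noteq> y \<Longrightarrow> x \<noteq> z \<Longrightarrow> y \<noteq> z \<Longrightarrow> v x y z = w x y z"
  shows "triple_sum v p = triple_sum w p"
proof -
  have pairs: "pair_sum (v x) q = pair_sum (w x) q" if "distinct q" "x \<notin> set q" for x q
    using that by (induction q) (auto intro!: arg_cong[where f = sum_list] assms(2))
  show ?thesis
    using assms(1) by (induction p) (auto simp: pairs)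
qed

lemma pair_sum_0 [simp]: "pair_sum (\<lambda>x y. 0) p = 0"
  by (induction p) auto

lemma pair_sum_eq_0:
  "(\<And>x y. x \<in> set p \<Longrightarrow> y \<in> set p \<Longrightarrow> w x y = 0) \<Longrightarrow> pair_sum w p = 0"
  using pair_sum_cong[of p w "\<lambda>x y. 0"] by simp

lemma pair_sum_map: "pair_sum w (map f p) = pair_sum (\<lambda>x y. w (f x) (f y)) p"
  by (induction p) (auto simp: comp_def)

lemma triple_sum_map: "triple_sum w (map f p) = triple_sum (\<lambda>x y z. w (f x) (f y) (f z)) p"
  by (induction p) (auto simp: pair_sum_map)

lemma pair_sum_rev: "pair_sum w (rev p) = pair_sum (\<lambda>x y. w y x) p"
  by (induction p) (auto simp: pair_sum_append sum_list_rev rev_map[symmetric])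

lemma triple_sum_rev: "triple_sum w (rev p) = triple_sum (\<lambda>x y z. w z y x) p"
  by (induction p) (auto simp: triple_sum_append pair_sum_rev)

text \<open>Each entry belongs to \<open>length p - 1\<close> pairs; the missing one is added on the
  left to avoid truncated subtraction.\<close>

lemma pair_sum_cross:
  "pair_sum (\<lambda>y z. f y + f z) p + sum_list (map f p) = length p * sum_list (map f p)"
  by (induction p) (auto simp: sum_list_addf sum_list_triv algebra_simps)

text \<open>Each pair lies in \<open>length p - 2\<close> triples, again written without
  subtraction.\<close>

lemma triple_sum_of_pairs:
  "triple_sum (\<lambda>x y z. w x y + w x z + w y z) p + 2 * pair_sum w p = length p * pair_sum w p"
proof (induction p)
  case (Cons x p)
  then show ?case
    using pair_sum_cross[of "w x" p] by (simp add: pair_sum_add algebra_simps)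
qed simp

section \<open>Pattern occurrences as sums over index triples\<close>

lemma pair_sum_nth: "pair_sum w p = (\<Sum>k<length p. \<Sum>j<k. w (p ! j) (p ! k))"
proof (induction p rule: rev_induct)
  case (snoc x p)
  have "(\<Sum>k<length p. \<Sum>j<k. w ((p @ [x]) ! j) ((p @ [x]) ! k))
      = (\<Sum>k<length p. \<Sum>j<k. w (p ! j) (p ! k))"
    by (intro sum.cong) (auto simp: nth_append)
  moreover have "(\<Sum>j<length p. w ((p @ [x]) ! j) x) = (\<Sum>a\<leftarrow>p. w a x)"
    by (auto simp: sum_list_sum_nth atLeast0LessThan nth_append intro!: sum.cong)
  ultimately show ?case
    using snoc by (simp add: pair_sum_append)
qed simp

lemma triple_sum_nth:
  "triple_sum w p = (\<Sum>k<length p. \<Sum>j<k. \<Sum>i<j. w (p ! i) (p ! j) (p ! k))"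
proof (induction p rule: rev_induct)
  case (snoc x p)
  have "(\<Sum>k<length p. \<Sum>j<k. \<Sum>i<j. w ((p @ [x]) ! i) ((p @ [x]) ! j) ((p @ [x]) ! k))
      = (\<Sum>k<length p. \<Sum>j<k. \<Sum>i<j. w (p ! i) (p ! j) (p ! k))"
    by (intro sum.cong) (auto simp: nth_append)
  moreover have "(\<Sum>j<length p. \<Sum>i<j. w ((p @ [x]) ! i) ((p @ [x]) ! j) x)
      = pair_sum (\<lambda>a b. w a b x) p"
    unfolding pair_sum_nth by (intro sum.cong) (auto simp: nth_append)
  ultimately show ?case
    using snoc by (simp add: triple_sum_append)
qed simp

text \<open>An occurrence is an index list \<open>[i, j, k]\<close> with \<open>i < j < k\<close>;
  \<open>P\<close> collects the comparisons that the pattern prescribes.\<close>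

lemma num_occ_triple:
  fixes p :: "nat list"
  assumes len: "length q = 3"
    and P: "\<And>x y z. P x y z \<longleftrightarrow>
      (\<forall>s<3. \<forall>t<3. [x, y, z] ! s < [x, y, z] ! t \<longleftrightarrow> q ! s < q ! t)"
  shows "num_occ q p = triple_sum (\<lambda>x y z. of_bool (P x y z)) p"
proof -
  define K where "K = (SIGMA k:{..<length p}. SIGMA j:{..<k}. {..<j})"
  define S where "S = {(k, j, i) \<in> K. P (p ! i) (p ! j) (p ! k)}"
  have fin: "finite K"
    by (auto simp: K_def)
  have nth3: "p ! ([i, j, k] ! s) = [p ! i, p ! j, p ! k] ! s" if "s < 3" for i j k s
    using that by (auto simp: less_Suc_eq numeral_3_eq_3)
  have P': "P (p ! i) (p ! j) (p ! k) \<longleftrightarrow>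
      (\<forall>s<3. \<forall>t<3. p ! ([i, j, k] ! s) < p ! ([i, j, k] ! t) \<longleftrightarrow> q ! s < q ! t)" for i j k
    unfolding P using nth3 by metis
  have "occurrences q p = (\<lambda>(k, j, i). [i, j, k]) ` S"
  proof (intro equalityI subsetI)
    fix js assume "js \<in> occurrences q p"
    then have js: "length js = 3" "sorted_wrt (<) js" "set js \<subseteq> {..<length p}"
      "\<forall>s<3. \<forall>t<3. p ! (js ! s) < p ! (js ! t) \<longleftrightarrow> q ! s < q ! t"
      by (auto simp: occurrences_def len)
    then obtain i j k where "js = [i, j, k]"
      by (auto simp: numeral_3_eq_3 length_Suc_conv)
    with js show "js \<in> (\<lambda>(k, j, i). [i, j, k]) ` S"
      by (auto simp: S_def K_def P' intro!: image_eqI[where x = "(k, j, i)"])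
  next
    fix js assume "js \<in> (\<lambda>(k, j, i). [i, j, k]) ` S"
    then obtain i j k where "js = [i, j, k]" "i < j" "j < k" "k < length p"
      "P (p ! i) (p ! j) (p ! k)"
      by (auto simp: S_def K_def)
    then show "js \<in> occurrences q p"
      by (auto simp: occurrences_def len P')
  qed
  moreover have "inj_on (\<lambda>(k, j, i). [i, j, k]) S"
    by (auto simp: inj_on_def)
  ultimately have "num_occ q p = card S"
    by (simp add: num_occ_def card_image)
  also have "\<dots> = (\<Sum>(k, j, i)\<in>K. of_bool (P (p ! i) (p ! j) (p ! k)))"
    using fin by (simp add: S_def of_bool_def case_prod_unfold sum.If_cases Int_def)
  also have "\<dots> = triple_sum (\<lambda>x y z. of_bool (P x y z)) p"
    unfolding triple_sum_nth K_def
    by (simp add: sum.Sigma[symmetric])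
  finally show ?thesis .
qed

lemma num_occ_patterns:
  fixes p :: "nat list"
  shows num_occ_123: "num_occ [1, 2, 3] p = triple_sum (\<lambda>x y z. of_bool (x < y \<and> y < z)) p"
    and num_occ_132: "num_occ [1, 3, 2] p = triple_sum (\<lambda>x y z. of_bool (x < z \<and> z < y)) p"
    and num_occ_213: "num_occ [2, 1, 3] p = triple_sum (\<lambda>x y z. of_bool (y < x \<and> x < z)) p"
    and num_occ_231: "num_occ [2, 3, 1] p = triple_sum (\<lambda>x y z. of_bool (z < x \<and> x < y)) p"
    and num_occ_312: "num_occ [3, 1, 2] p = triple_sum (\<lambda>x y z. of_bool (y < z \<and> z < x)) p"
  by (rule num_occ_triple; auto simp: numeral_3_eq_3 less_Suc_eq)+


section \<open>Avoidance and heights, read entry by entry from the left\<close>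

text \<open>Treats both classes at once: \<open>x\<close> plays the letter 1, and \<open>R\<close>
  is the forbidden order of the two larger letters, \<open>(<)\<close> for 123 and
  \<open>(>)\<close> for 132.\<close>

primrec avoids_above :: "(nat \<Rightarrow> nat \<Rightarrow> bool) \<Rightarrow> nat list \<Rightarrow> bool" where
  "avoids_above R [] \<longleftrightarrow> True"
| "avoids_above R (x # p) \<longleftrightarrow>
     sorted_wrt (\<lambda>a b. x < a \<and> x < b \<longrightarrow> \<not> R a b) p \<and> avoids_above R p"

text \<open>
  The values \<open>u\<close> of the left-to-right minima, where only entries below \<open>m\<close> are eligible as minima: \<open>m\<close> is
  the smallest entry read so far, initially any bound exceeding all entries.
\<close>

primrec heights :: "nat \<Rightarrow> nat list \<Rightarrow> nat list" where
  "heights m [] = []"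
| "heights m (x # p) =
     (if x < m then length (filter ((<) x) p) # heights x p else heights m p)"

lemma pair_sum_eq_0_iff:
  "pair_sum (\<lambda>x y. of_bool (P x y)) p = 0 \<longleftrightarrow> sorted_wrt (\<lambda>x y. \<not> P x y) p"
  by (induction p) auto

lemma avoids_123: "avoids p [1, 2, 3] \<longleftrightarrow> avoids_above (<) p"
proof -
  have "triple_sum (\<lambda>x y z. of_bool (x < y \<and> y < z)) p = 0 \<longleftrightarrow> avoids_above (<) p"
    by (induction p) (auto simp: pair_sum_eq_0_iff elim!: sorted_wrt_mono_rel[rotated])
  then show ?thesis
    by (simp only: avoids_def num_occ_123)
qed

lemma avoids_132: "avoids p [1, 3, 2] \<longleftrightarrow> avoids_above (>) p"
proof -
  have "triple_sum (\<lambda>x y z. of_bool (x < z \<and> z < y)) p = 0 \<longleftrightarrow> avoids_above (>) p"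
    by (induction p) (auto simp: pair_sum_eq_0_iff elim!: sorted_wrt_mono_rel[rotated])
  then show ?thesis
    by (simp only: avoids_def num_occ_132)
qed

text \<open>Entries above \<open>m\<close> are also above \<open>x\<close>, and \<open>x\<close>
  itself is not above \<open>m\<close>, so the condition at \<open>m\<close> follows from the one at
  \<open>x\<close>.\<close>

lemma avoids_above_Cons_less:
  assumes "x < m"
  shows "avoids_above R (m # x # p) \<longleftrightarrow> avoids_above R (x # p)"
  using assms by (auto elim!: sorted_wrt_mono_rel[rotated])

text \<open>Entries above \<open>x\<close> are above \<open>m\<close>, so the condition at
  \<open>x\<close> follows from the one at \<open>m\<close>; only pairs that start with
  \<open>x\<close> are new.\<close>

lemma avoids_above_Cons_greater:
  assumes "m < x"
  shows "avoids_above R (m # x # p) \<longleftrightarrow>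
    (\<forall>b\<in>set p. m < b \<longrightarrow> \<not> R x b) \<and> avoids_above R (m # p)"
  using assms by (auto elim!: sorted_wrt_mono_rel[rotated])

text \<open>An entry above all others starts no forbidden pattern; it will serve as a virtual
  initial minimum.\<close>

lemma avoids_above_Cons_top:
  assumes "\<forall>x\<in>set p. x < m"
  shows "avoids_above R (m # p) \<longleftrightarrow> avoids_above R p"
proof -
  have "sorted_wrt (\<lambda>a b. m < a \<and> m < b \<longrightarrow> \<not> R a b) p"
    using assms by (induction p) auto
  then show ?thesis
    by simp
qed

text \<open>
  The next entry is either one of the \<open>l\<close> remaining values below the current minimum, the new minimum
  having \<open>j\<close> values below it, or the only one of the \<open>k\<close> values above it that avoidance permits: the
  largest for \<open>123\<close>, the smallest for \<open>132\<close>.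
\<close>

function height_sum :: "nat \<Rightarrow> nat \<Rightarrow> (nat list \<Rightarrow> int) \<Rightarrow> int" where
  "height_sum k l h = (if k + l = 0 then h [] else
     (\<Sum>j<l. height_sum (k + l - 1 - j) j (\<lambda>us. h ((k + l - 1 - j) # us)))
     + (if k = 0 then 0 else height_sum (k - 1) l h))"
  by auto
termination
  by (relation "measure (\<lambda>(k, l, h). k + l)") auto

declare height_sum.simps [simp del]

text \<open>Turns a sum over the possible new minima into a sum over the number \<open>j\<close> of
  values below them.\<close>

lemma bij_betw_rank:
  fixes A :: "nat set"
  assumes "finite A"
  shows "bij_betw (\<lambda>x. card {a \<in> A. a < x}) {x \<in> A. x < m} {..<card {x \<in> A. x < m}}"
proof -
  have less: "card {a \<in> A. a < x} < card {a \<in> A. a < y}" if "x \<in> A" "x < y" for x y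
    using that assms by (intro psubset_card_mono) auto
  have inj: "inj_on (\<lambda>x. card {a \<in> A. a < x}) {x \<in> A. x < m}"
    by (rule inj_onI) (metis (mono_tags, lifting) less less_irrefl linorder_neqE_nat mem_Collect_eq)
  moreover have "(\<lambda>x. card {a \<in> A. a < x}) ` {x \<in> A. x < m} \<subseteq> {..<card {x \<in> A. x < m}}"
    using less by auto
  ultimately have "(\<lambda>x. card {a \<in> A. a < x}) ` {x \<in> A. x < m} = {..<card {x \<in> A. x < m}}"
    by (intro card_subset_eq) (auto simp: card_image)
  with inj show ?thesis
    by (simp add: bij_betw_def)
qed

text \<open>Both orders \<open>R\<close> leave equally many choices for the first entry, with the
  same numbers of values above and below the current minimum afterwards, so \<open>R\<close> drops
  out. \<open>h\<close> is arbitrary in the induction because it absorbs the heights already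
  read.\<close>

lemma sum_heights_avoids_above:
  fixes A :: "nat set"
  assumes "finite A" "m \<notin> A" "R = (<) \<or> R = (>)"
  shows "(\<Sum>p | p \<in> permutations_of_set A \<and> avoids_above R (m # p). h (heights m p))
    = height_sum (card {a \<in> A. m < a}) (card {a \<in> A. a < m}) h"
  using assms(1,2)
proof (induction "card A" arbitrary: A m h rule: less_induct)
  case less
  show ?case
  proof (cases "A = {}")
    case True
    then have "{p. p \<in> permutations_of_set A \<and> avoids_above R (m # p)} = {[]}"
      by auto
    with True show ?thesis
      by (simp add: height_sum.simps)
  next
    case False
    define k l where "k = card {a \<in> A. m < a}" and "l = card {a \<in> A. a < m}"
    define Lo Hi where "Lo = {x \<in> A. x < m}" and "Hi = {x \<in> A. m < x}"
    define B where
      "B x = {p. p \<in> permutations_of_set (A - {x}) \<and> avoids_above R (m # x # p)}" for x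
    define G where "G x = (\<Sum>p\<in>B x. h (heights m (x # p)))" for x
    have A: "A = Lo \<union> Hi" "Lo \<inter> Hi = {}"
      using less.prems by (auto simp: Lo_def Hi_def) (metis linorder_neqE_nat)
    have fin: "finite Lo" "finite Hi" "finite (B x)" for x
      using less.prems by (auto simp: Lo_def Hi_def B_def)
    have kl: "card A = k + l"
      unfolding k_def l_def using A fin less.prems
      by (metis Lo_def Hi_def add.commute card_Un_disjoint)
    have smaller: "card (A - {x}) < card A" if "x \<in> A" for x
      using that less.prems by (meson card_Diff1_less)
    have "bij_betw (\<lambda>(x, p). x # p) (SIGMA x:A. B x)
        {p. p \<in> permutations_of_set A \<and> avoids_above R (m # p)}"
      unfolding bij_betw_def
    proof (intro conjI)
      show "inj_on (\<lambda>(x, p). x # p) (SIGMA x:A. B x)"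
        by (auto simp: inj_on_def)
      show "(\<lambda>(x, p). x # p) ` (SIGMA x:A. B x)
          = {p. p \<in> permutations_of_set A \<and> avoids_above R (m # p)}"
        using permutations_of_set_nonempty[OF False] unfolding B_def
        by (auto simp del: avoids_above.simps simp: image_iff)
    qed
    from sum.reindex_bij_betw[OF this, of "\<lambda>p. h (heights m p)", symmetric]
    have "(\<Sum>p | p \<in> permutations_of_set A \<and> avoids_above R (m # p). h (heights m p))
        = (\<Sum>(x, p)\<in>(SIGMA x:A. B x). h (heights m (x # p)))"
      by (simp add: case_prod_unfold)
    also have "\<dots> = (\<Sum>x\<in>A. G x)"
      unfolding G_def using fin less.prems by (simp add: sum.Sigma)
    also have "\<dots> = (\<Sum>x\<in>Lo. G x) + (\<Sum>x\<in>Hi. G x)"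
      using A fin by (simp add: sum.union_disjoint)
    also have "(\<Sum>x\<in>Lo. G x)
        = (\<Sum>x\<in>Lo. (\<lambda>j. height_sum (k + l - 1 - j) j (\<lambda>us. h ((k + l - 1 - j) # us)))
            (card {a \<in> A. a < x}))"
    proof (intro sum.cong refl)
      fix x assume "x \<in> Lo"
      then have x: "x \<in> A" "x < m"
        by (auto simp: Lo_def)
      have "card (A - {x}) = card ({a \<in> A. x < a} \<union> {a \<in> A. a < x})"
        by (rule arg_cong[where f = card]) auto
      also have "\<dots> = card {a \<in> A. x < a} + card {a \<in> A. a < x}"
        using less.prems(1) by (intro card_Un_disjoint) auto
      finally have "card (A - {x}) = card {a \<in> A. x < a} + card {a \<in> A. a < x}" .
      \<comment> \<open>Besides \<open>x\<close> there are \<open>k + l - 1\<close> values, and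
        those not below \<open>x\<close> are above it. All of them come later, so this is the height
        of \<open>x\<close>.\<close>
      then have above: "card {a \<in> A. x < a} = k + l - 1 - card {a \<in> A. a < x}"
        using x kl less.prems by simp
      have B: "B x = {p. p \<in> permutations_of_set (A - {x}) \<and> avoids_above R (x # p)}"
        unfolding B_def using avoids_above_Cons_less[OF x(2)] by blast
      have "length (filter ((<) x) p) = card {a \<in> A. x < a}" if "p \<in> B x" for p
      proof -
        have "distinct p" "set p = A - {x}"
          using that by (auto simp: B permutations_of_set_def)
        then have "length (filter ((<) x) p) = card (set (filter ((<) x) p))"
          by (metis distinct_card distinct_filter)
        also have "set (filter ((<) x) p) = {a \<in> A. x < a}"
          using \<open>set p = A - {x}\<close> by auto
        finally show ?thesis .
      qed
      then have "G x = (\<Sum>p\<in>B x. h (card {a \<in> A. x < a} # heights x p))"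
        unfolding G_def using x by simp
      also have "\<dots> = height_sum (card {a \<in> A - {x}. x < a}) (card {a \<in> A - {x}. a < x})
          (\<lambda>us. h (card {a \<in> A. x < a} # us))"
        unfolding B using less.prems x smaller
        by (intro less.hyps[where h = "\<lambda>us. h (card {a \<in> A. x < a} # us)"]) auto
      also have "{a \<in> A - {x}. x < a} = {a \<in> A. x < a}"
        by auto
      also have "{a \<in> A - {x}. a < x} = {a \<in> A. a < x}"
        by auto
      finally show "G x = (\<lambda>j. height_sum (k + l - 1 - j) j (\<lambda>us. h ((k + l - 1 - j) # us)))
          (card {a \<in> A. a < x})"
        by (simp only: above)
    qed
    also have "\<dots> = (\<Sum>j<l. height_sum (k + l - 1 - j) j (\<lambda>us. h ((k + l - 1 - j) # us)))"
      unfolding Lo_def l_def using less.prems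
      by (intro sum.reindex_bij_betw bij_betw_rank)
    also have "(\<Sum>x\<in>Hi. G x) = (if k = 0 then 0 else height_sum (k - 1) l h)"
    proof (cases "Hi = {}")
      case True
      then show ?thesis
        by (simp add: k_def Hi_def[symmetric])
    next
      case False
      \<comment> \<open>\<open>e\<close> is the largest value above \<open>m\<close> for
        \<open>(<)\<close> and the smallest for \<open>(>)\<close>.\<close>
      then have "\<exists>e\<in>Hi. \<forall>b\<in>Hi - {e}. R b e"
        using assms(3) fin(2)
        by (metis DiffE Max_ge Max_in Min_in Min_le insertI1 le_neq_implies_less)
      then obtain e where e: "e \<in> Hi" "\<And>b. b \<in> Hi \<Longrightarrow> b \<noteq> e \<Longrightarrow> R b e"
        by blast
      \<comment> \<open>Any other \<open>x\<close> would be followed later by \<open>e\<close>,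
        completing a forbidden pattern with \<open>m\<close>.\<close>
      have empty: "B x = {}" if "x \<in> Hi" "x \<noteq> e" for x
      proof -
        have "m < x" "m < e" "e \<in> A - {x}" "R x e"
          using that e by (auto simp: Hi_def)
        then show ?thesis
          unfolding B_def
          by (auto simp: avoids_above_Cons_greater permutations_of_set_def simp del: avoids_above.simps)
      qed
      have nR: "\<not> R e b" if "b \<in> A - {e}" "m < b" for b
        using e(2)[of b] that assms(3) by (auto simp: Hi_def)
      have me: "m < e" "e \<in> A"
        using e by (auto simp: Hi_def)
      have B: "B e = {p. p \<in> permutations_of_set (A - {e}) \<and> avoids_above R (m # p)}"
        unfolding B_def using nR
        by (auto simp: avoids_above_Cons_greater[OF me(1)] permutations_of_set_def
            simp del: avoids_above.simps)
      have "(\<Sum>x\<in>Hi. G x) = G e"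
        using e(1) fin empty by (subst sum.remove[of _ e]) (auto simp: G_def)
      also have "\<dots> = (\<Sum>p\<in>B e. h (heights m p))"
        unfolding G_def using me by simp
      also have "\<dots> = height_sum (card {a \<in> A - {e}. m < a}) (card {a \<in> A - {e}. a < m}) h"
        unfolding B using less.prems smaller[OF me(2)] by (intro less.hyps) auto
      also have "{a \<in> A - {e}. m < a} = Hi - {e}"
        by (auto simp: Hi_def)
      also have "{a \<in> A - {e}. a < m} = Lo"
        using me by (auto simp: Lo_def)
      finally show ?thesis
        using e(1) fin False by (auto simp: k_def l_def Hi_def[symmetric] Lo_def[symmetric])
    qed
    finally show ?thesis
      using kl False less.prems
      by (subst height_sum.simps) (auto simp: k_def[symmetric] l_def[symmetric])
  qed
qed

section \<open>Equidistribution of the heights over the two classes\<close>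

lemma in_Sym_iff: "p \<in> Sym n \<longleftrightarrow> distinct p \<and> set p = {1..n}"
  by (auto simp: Sym_def permutations_of_set_def)

lemma length_Sym: "p \<in> Sym n \<Longrightarrow> length p = n"
  by (auto simp: Sym_def dest: length_finite_permutations_of_set)

lemma in_Av_123_iff: "p \<in> Av n [1, 2, 3] \<longleftrightarrow> p \<in> Sym n \<and> avoids_above (<) p"
  unfolding Av_def avoids_123 by simp

lemma in_Av_132_iff: "p \<in> Av n [1, 3, 2] \<longleftrightarrow> p \<in> Sym n \<and> avoids_above (>) p"
  unfolding Av_def avoids_132 by simp

text \<open>With \<open>Suc n\<close> prepended as a virtual minimum, both sums are the same
  instance of \<open>height_sum\<close>.\<close>

lemma sum_heights_Av:
  fixes h :: "nat list \<Rightarrow> int"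
  shows "(\<Sum>p\<in>Av n [1, 2, 3]. h (heights (Suc n) p)) = (\<Sum>p\<in>Av n [1, 3, 2]. h (heights (Suc n) p))"
proof -
  have top: "avoids_above R (Suc n # p) \<longleftrightarrow> avoids_above R p" if "p \<in> Sym n" for R p
    using that by (intro avoids_above_Cons_top) (auto simp: in_Sym_iff)
  have "Av n [1, 2, 3] = {p. p \<in> permutations_of_set {1..n} \<and> avoids_above (<) (Suc n # p)}"
    "Av n [1, 3, 2] = {p. p \<in> permutations_of_set {1..n} \<and> avoids_above (>) (Suc n # p)}"
    using top by (auto simp: in_Av_123_iff in_Av_132_iff Sym_def simp del: avoids_above.simps One_nat_def)
  then show ?thesis
    using sum_heights_avoids_above[of "{1..n}" "Suc n" "(<)" h]
      sum_heights_avoids_above[of "{1..n}" "Suc n" "(>)" h]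
    by (simp del: avoids_above.simps One_nat_def)
qed


section \<open>Reverse-complement symmetry of the 123-avoiders\<close>

definition reverse_complement :: "nat \<Rightarrow> nat list \<Rightarrow> nat list" where
  "reverse_complement n p = map (\<lambda>x. Suc n - x) (rev p)"

lemma reverse_complement_Sym: "p \<in> Sym n \<Longrightarrow> reverse_complement n p \<in> Sym n"
proof -
  assume "p \<in> Sym n"
  then have p: "distinct p" "set p = {1..n}"
    by (auto simp: in_Sym_iff)
  have inj: "inj_on (\<lambda>x. Suc n - x) {1..n}"
    by (auto simp: inj_on_def)
  then have "(\<lambda>x. Suc n - x) ` {1..n} = {1..n}"
    by (intro endo_inj_surj) auto
  with inj show ?thesis
    using p by (simp add: in_Sym_iff reverse_complement_def distinct_map)
qed

lemma reverse_complement_involution: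
  "p \<in> Sym n \<Longrightarrow> reverse_complement n (reverse_complement n p) = p"
  unfolding reverse_complement_def in_Sym_iff rev_map[symmetric]
  by (auto simp: comp_def intro!: map_idI)

lemma num_occ_reverse_complement:
  assumes "p \<in> Sym n"
  shows "num_occ [1, 2, 3] (reverse_complement n p) = num_occ [1, 2, 3] p"
    and "num_occ [2, 1, 3] (reverse_complement n p) = num_occ [1, 3, 2] p"
    and "num_occ [3, 1, 2] (reverse_complement n p) = num_occ [2, 3, 1] p"
proof -
  have "set p \<subseteq> {1..n}"
    using assms by (auto simp: in_Sym_iff)
  then have "Suc n - x < Suc n - y \<longleftrightarrow> y < x" if "x \<in> set p" "y \<in> set p" for x y
    using that by force
  then show "num_occ [1, 2, 3] (reverse_complement n p) = num_occ [1, 2, 3] p"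
    and "num_occ [2, 1, 3] (reverse_complement n p) = num_occ [1, 3, 2] p"
    and "num_occ [3, 1, 2] (reverse_complement n p) = num_occ [2, 3, 1] p"
    unfolding num_occ_patterns reverse_complement_def triple_sum_map triple_sum_rev
    by (auto intro!: triple_sum_cong)
qed

text \<open>The map preserves the number of 123s, hence is an involution on the class, and each
  total can be reindexed along it.\<close>

lemma total_occ_reverse_complement:
  shows "total_occ [2, 1, 3] (Av n [1, 2, 3]) = total_occ [1, 3, 2] (Av n [1, 2, 3])"
    and "total_occ [3, 1, 2] (Av n [1, 2, 3]) = total_occ [2, 3, 1] (Av n [1, 2, 3])"
proof -
  have *: "reverse_complement n p \<in> Av n [1, 2, 3]" if "p \<in> Av n [1, 2, 3]" for p
    using that reverse_complement_Sym num_occ_reverse_complement(1)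
    unfolding Av_def avoids_def by auto
  have Sym: "p \<in> Sym n" if "p \<in> Av n r" for p r
    using that by (simp add: Av_def)
  have "total_occ q (Av n [1, 2, 3]) = (\<Sum>p\<in>Av n [1, 2, 3]. num_occ q (reverse_complement n p))"
    for q
    unfolding total_occ_def
    by (rule sum.reindex_bij_witness[of _ "reverse_complement n" "reverse_complement n"])
      (auto simp: reverse_complement_involution Sym simp del: One_nat_def intro: *)
  then show "total_occ [2, 1, 3] (Av n [1, 2, 3]) = total_occ [1, 3, 2] (Av n [1, 2, 3])"
    and "total_occ [3, 1, 2] (Av n [1, 2, 3]) = total_occ [2, 3, 1] (Av n [1, 2, 3])"
    unfolding total_occ_def[of "[1, 3, 2]"] total_occ_def[of "[2, 3, 1]"]
    using Sym num_occ_reverse_complement(2,3) by (auto intro!: sum.cong simp del: One_nat_def)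
qed

section \<open>Counting 231 over 123-avoiders\<close>

lemma sum_list_of_bool: "(\<Sum>y\<leftarrow>p. of_bool (P y)) = length (filter P p)"
  by (induction p) auto

text \<open>The entries above \<open>x\<close> decrease, so every pair of them counts:
  \<open>c\<close> choose 2, in subtraction-free form.\<close>

lemma pair_sum_decreasing_above:
  fixes p :: "nat list"
  assumes "sorted_wrt (\<lambda>a b. x < a \<and> x < b \<longrightarrow> \<not> a < b) p" "distinct p"
  defines "c \<equiv> length (filter ((<) x) p)"
  shows "2 * pair_sum (\<lambda>y z. of_bool (x < z \<and> z < y)) p + c = c * c"
  using assms(1,2) unfolding c_def
proof (induction p)
  case (Cons y p)
  show ?case
  proof (cases "x < y")
    case True
    have "filter (\<lambda>z. x < z \<and> z < y) p = filter ((<) x) p"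
      using Cons.prems True by (intro filter_cong) (auto simp: not_less le_less)
    with Cons True show ?thesis
      by (simp add: sum_list_of_bool)
  next
    case False
    then have "filter (\<lambda>z. x < z \<and> z < y) p = []"
      by auto
    with Cons False show ?thesis
      by (simp add: sum_list_of_bool)
  qed
qed simp

text \<open>Only a minimum starts ascents, and it starts one for each later larger entry.\<close>

lemma pair_sum_ascents_heights:
  assumes "avoids_above (<) (m # p)" "distinct (m # p)"
  shows "pair_sum (\<lambda>x y. of_bool (x < y)) p = sum_list (heights m p)"
  using assms
proof (induction p arbitrary: m)
  case (Cons x p)
  show ?case
  proof (cases "x < m")
    case True
    with Cons show ?thesis
      using avoids_above_Cons_less[OF True, of "(<)" p] Cons.IH[of x]
      by (auto simp: sum_list_of_bool)
  next
    case False
    then have "m < x"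
      using Cons.prems by auto
    \<comment> \<open>\<open>m\<close> lies below \<open>x\<close>, so a later entry above
      \<open>x\<close> would complete a 123.\<close>
    then have "avoids_above (<) (m # p)" "\<forall>b\<in>set p. \<not> x < b"
      using Cons.prems(1) avoids_above_Cons_greater[of m x "(<)" p] by auto
    with Cons False show ?thesis
      by (simp add: sum_list_of_bool)
  qed
qed simp

text \<open>A 132 starts at a minimum, and any two of its \<open>u\<close> later larger entries
  complete it: \<open>u\<close> choose 2 occurrences.\<close>

lemma num_occ_132_heights:
  assumes "avoids_above (<) (m # p)" "distinct (m # p)"
  shows "2 * num_occ [1, 3, 2] p + sum_list (heights m p) = (\<Sum>u\<leftarrow>heights m p. u * u)"
  unfolding num_occ_132 using assms
proof (induction p arbitrary: m)
  case (Cons x p)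
  show ?case
  proof (cases "x < m")
    case True
    then have "avoids_above (<) (x # p)"
      using Cons.prems(1) avoids_above_Cons_less by blast
    then show ?thesis
      using Cons.IH[of x] Cons.prems(2) pair_sum_decreasing_above[of x p] True by simp
  next
    case False
    then have "m < x"
      using Cons.prems by auto
    then have "avoids_above (<) (m # p)" "\<forall>b\<in>set p. \<not> x < b"
      using Cons.prems(1) avoids_above_Cons_greater[of m x "(<)" p] by auto
    with Cons False show ?thesis
      by (simp add: pair_sum_eq_0)
  qed
qed simp

lemma num_occ_heights:
  assumes "p \<in> Av n [1, 2, 3]"
  defines "us \<equiv> heights (Suc n) p"
  shows "num_occ [2, 3, 1] p + num_occ [3, 1, 2] p + 2 * num_occ [1, 3, 2] p
      + 2 * num_occ [2, 1, 3] p + 2 * sum_list us = n * sum_list us"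
proof -
  define asc :: "nat \<Rightarrow> nat \<Rightarrow> nat" where "asc x y = of_bool (x < y)" for x y
  have p: "distinct p" "set p = {1..n}" "length p = n" "avoids_above (<) p"
    using assms(1) length_Sym by (auto simp: in_Av_123_iff in_Sym_iff simp del: One_nat_def)
  have av: "avoids_above (<) (Suc n # p)"
    using p avoids_above_Cons_top[of p "Suc n"] by auto
  have "num_occ [1, 2, 3] p = 0"
    using assms(1) by (simp only: Av_def avoids_def mem_Collect_eq)
  \<comment> \<open>Ascents in a triple: three in 123, two in 132 and 213, one in 231 and 312, none
    in 321.\<close>
  moreover have "triple_sum (\<lambda>x y z. asc x y + asc x z + asc y z) p
    = triple_sum (\<lambda>x y z. of_bool (x < y \<and> y < z) + of_bool (x < y \<and> y < z)
        + of_bool (x < y \<and> y < z) + of_bool (x < z \<and> z < y) + of_bool (x < z \<and> z < y)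
        + of_bool (y < x \<and> x < z) + of_bool (y < x \<and> x < z)
        + of_bool (z < x \<and> x < y) + of_bool (y < z \<and> z < x)) p"
    using p(1)
  proof (rule triple_sum_cong_distinct)
    fix x y z :: nat
    assume "x \<noteq> y" "x \<noteq> z" "y \<noteq> z"
    then consider "x < y" "y < z" | "x < z" "z < y" | "y < x" "x < z" | "y < z" "z < x"
      | "z < x" "x < y" | "z < y" "y < x"
      by linarith
    then show "asc x y + asc x z + asc y z =
        of_bool (x < y \<and> y < z) + of_bool (x < y \<and> y < z)
        + of_bool (x < y \<and> y < z) + of_bool (x < z \<and> z < y) + of_bool (x < z \<and> z < y)
        + of_bool (y < x \<and> x < z) + of_bool (y < x \<and> x < z)
        + of_bool (z < x \<and> x < y) + of_bool (y < z \<and> z < x)"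
      by cases (simp_all add: asc_def)
  qed
  ultimately have "triple_sum (\<lambda>x y z. asc x y + asc x z + asc y z) p
    = num_occ [2, 3, 1] p + num_occ [3, 1, 2] p + 2 * num_occ [1, 3, 2] p
      + 2 * num_occ [2, 1, 3] p"
    unfolding num_occ_patterns triple_sum_add by simp
  moreover have "pair_sum asc p = sum_list us"
    unfolding us_def asc_def using av p by (intro pair_sum_ascents_heights) auto
  ultimately show ?thesis
    using triple_sum_of_pairs[of asc p] p(3) by simp
qed

text \<open>The counts of 132 and 213 can differ for a single permutation and cancel only in the
  totals. Integers are used because a summand can be negative, as for
  \<open>[1, 3, 2]\<close>.\<close>

lemma total_occ_231_Av_123:
  "2 * int (total_occ [2, 3, 1] (Av n [1, 2, 3])) =
    (\<Sum>p\<in>Av n [1, 2, 3]. int n * int (sum_list (heights (Suc n) p))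
        - 2 * int (\<Sum>u\<leftarrow>heights (Suc n) p. u * u))"
proof -
  have "int (num_occ [2, 3, 1] p) + int (num_occ [3, 1, 2] p)
      + 2 * int (num_occ [2, 1, 3] p) - 2 * int (num_occ [1, 3, 2] p)
      = int n * int (sum_list (heights (Suc n) p)) - 2 * int (\<Sum>u\<leftarrow>heights (Suc n) p. u * u)"
    if "p \<in> Av n [1, 2, 3]" for p
  proof -
    have p: "distinct (Suc n # p)" "avoids_above (<) (Suc n # p)"
      using that avoids_above_Cons_top[of p "Suc n"]
      by (auto simp: in_Av_123_iff in_Sym_iff simp del: One_nat_def)
    \<comment> \<open>Twice \<open>num_occ_132_heights\<close> is subtracted, so that 213 and 132
      get opposite coefficients.\<close>
    show ?thesis
      using num_occ_heights[OF that, THEN arg_cong[where f = int]]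
        num_occ_132_heights[OF p(2,1), THEN arg_cong[where f = int]]
      unfolding of_nat_add of_nat_mult of_nat_numeral by linarith
  qed
  then have "(\<Sum>p\<in>Av n [1, 2, 3]. int n * int (sum_list (heights (Suc n) p))
        - 2 * int (\<Sum>u\<leftarrow>heights (Suc n) p. u * u))
    = (\<Sum>p\<in>Av n [1, 2, 3]. int (num_occ [2, 3, 1] p) + int (num_occ [3, 1, 2] p)
      + 2 * int (num_occ [2, 1, 3] p) - 2 * int (num_occ [1, 3, 2] p))"
    by (intro sum.cong) simp_all
  also have "\<dots> = int (total_occ [2, 3, 1] (Av n [1, 2, 3]))
      + int (total_occ [3, 1, 2] (Av n [1, 2, 3]))
      + 2 * int (total_occ [2, 1, 3] (Av n [1, 2, 3]))
      - 2 * int (total_occ [1, 3, 2] (Av n [1, 2, 3]))"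
    unfolding total_occ_def
    by (simp add: sum.distrib sum_subtractf sum_distrib_left del: One_nat_def)
  finally show ?thesis
    by (simp add: total_occ_reverse_complement del: One_nat_def)
qed

section \<open>Decomposition of 132-avoiders at the maximum\<close>

unbundle fps_syntax

text \<open>In a 132-avoider every entry before the maximum exceeds every entry after it, hence the
  shift of \<open>L\<close> by \<open>length R\<close>.\<close>

definition glue :: "nat list \<Rightarrow> nat list \<Rightarrow> nat list" where
  "glue L R = map (\<lambda>x. x + length R) L @ Suc (length L + length R) # R"

lemma length_glue: "length (glue L R) = Suc (length L + length R)"
  by (simp add: glue_def)

text \<open>The lifted \<open>L\<close> lies above \<open>R\<close>. Ascents across the parts go
  only from \<open>L\<close> to the maximum, and no 132 crosses. A crossing 231 ends in
  \<open>R\<close>, and its first two letters are an ascent of \<open>L\<close> or an entry of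
  \<open>L\<close> and the maximum.\<close>

lemma num_occ_glue:
  assumes "L \<in> Sym l" "R \<in> Sym r"
  shows pair_sum_glue: "pair_sum (\<lambda>x y. of_bool (x < y)) (glue L R) =
      pair_sum (\<lambda>x y. of_bool (x < y)) L + pair_sum (\<lambda>x y. of_bool (x < y)) R + l"
    and num_occ_132_glue: "num_occ [1, 3, 2] (glue L R) = num_occ [1, 3, 2] L + num_occ [1, 3, 2] R"
    and num_occ_231_glue: "num_occ [2, 3, 1] (glue L R) = num_occ [2, 3, 1] L + num_occ [2, 3, 1] R
      + l * r + pair_sum (\<lambda>x y. of_bool (x < y)) L * r"
proof -
  have len: "length L = l" "length R = r"
    using assms length_Sym by auto
  have LR: "0 < x" "x \<le> l" "0 < y" "y \<le> r" if "x \<in> set L" "y \<in> set R" for x y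
    using that assms by (auto simp: in_Sym_iff)
  have L: "0 < x" "x \<le> l" if "x \<in> set L" for x
    using that assms by (auto simp: in_Sym_iff)
  have R: "0 < x" "x \<le> r" if "x \<in> set R" for x
    using that assms by (auto simp: in_Sym_iff)
  have sum_0: "sum_list (map f xs) = 0" if "\<And>x. x \<in> set xs \<Longrightarrow> f x = 0"
    for f :: "nat \<Rightarrow> nat" and xs
    using that by (induction xs) auto
  have sum_c: "sum_list (map f xs) = length xs * c" if "\<And>x. x \<in> set xs \<Longrightarrow> f x = c"
    for f :: "nat \<Rightarrow> nat" and xs c
    using that by (induction xs) auto
  let ?N = "Suc (l + r)" and ?asc = "\<lambda>x y :: nat. of_bool (x < y) :: nat"
  have NR: "sum_list (map (?asc ?N) R) = 0"
    using R by (intro sum_0) force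
  have "sum_list (map (?asc (x + r)) (?N # R)) = 1" if "x \<in> set L" for x
    using sum_0[of R "?asc (x + r)"] LR[OF that] L[OF that] by force
  then have "(\<Sum>x\<leftarrow>L. sum_list (map (?asc (x + r)) (?N # R))) = l"
    using sum_c[of L _ 1] len by simp
  with NR show "pair_sum ?asc (glue L R) = pair_sum ?asc L + pair_sum ?asc R + l"
    unfolding glue_def len pair_sum_append by (simp add: pair_sum_map comp_def)
  show "num_occ [1, 3, 2] (glue L R) = num_occ [1, 3, 2] L + num_occ [1, 3, 2] R"
  proof -
    let ?w = "\<lambda>x y z :: nat. of_bool (x < z \<and> z < y) :: nat"
    have "pair_sum (?w ?N) R = 0"
      using R by (intro pair_sum_eq_0) force
    moreover have "(\<Sum>x\<leftarrow>L. pair_sum (?w (x + r)) (?N # R)) = 0"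
      using LR L R by (intro sum_0 pair_sum_eq_0) fastforce
    moreover have "(\<Sum>z\<leftarrow>?N # R. pair_sum (\<lambda>a b. ?w (a + r) (b + r) z) L) = 0"
      using LR L R by (intro sum_0 pair_sum_eq_0) fastforce
    ultimately show ?thesis
      unfolding num_occ_132 glue_def len triple_sum_append
      by (simp add: triple_sum_map pair_sum_map comp_def)
  qed
  show "num_occ [2, 3, 1] (glue L R) = num_occ [2, 3, 1] L + num_occ [2, 3, 1] R
      + l * r + pair_sum ?asc L * r"
  proof -
    let ?w = "\<lambda>x y z :: nat. of_bool (z < x \<and> x < y) :: nat"
    have NR: "pair_sum (?w ?N) R = 0"
      using R by (intro pair_sum_eq_0) force
    have "pair_sum (?w (x + r)) (?N # R) = r" if "x \<in> set L" for x
    proof -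
      have "sum_list (map (?w (x + r) ?N) R) = r"
        using sum_c[of R "?w (x + r) ?N" 1] LR[OF that] L[OF that] len by fastforce
      moreover have "pair_sum (?w (x + r)) R = 0"
        using R by (intro pair_sum_eq_0) force
      ultimately show ?thesis
        by simp
    qed
    then have LR': "(\<Sum>x\<leftarrow>L. pair_sum (?w (x + r)) (?N # R)) = l * r"
      using sum_c[of L _ r] len by simp
    have LN: "pair_sum (\<lambda>a b. ?w (a + r) (b + r) ?N) L = 0"
      using L by (intro pair_sum_eq_0) force
    have "pair_sum (\<lambda>a b. ?w (a + r) (b + r) z) L = pair_sum ?asc L" if "z \<in> set R" for z
      using LR that by (intro pair_sum_cong) force
    then have "(\<Sum>z\<leftarrow>R. pair_sum (\<lambda>a b. ?w (a + r) (b + r) z) L) = pair_sum ?asc L * r"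
      using sum_c[of R _ "pair_sum ?asc L"] len by simp
    with NR LR' LN show ?thesis
      unfolding num_occ_231 glue_def len triple_sum_append
      by (simp add: triple_sum_map pair_sum_map comp_def)
  qed
qed

text \<open>Each entry of \<open>xs\<close> gains exactly \<open>N\<close> as a later larger entry.
  \<open>N\<close> can be a minimum only when \<open>xs\<close> is empty, and then has height 0. All
  of \<open>ys\<close> lies below what precedes it, so its initial bound may be taken to be
  \<open>N\<close>.\<close>

lemma heights_append_max:
  assumes "\<And>x. x \<in> set xs \<Longrightarrow> x < N" "\<And>y. y \<in> set ys \<Longrightarrow> y < N \<and> y < m"
    and "\<And>x y. x \<in> set xs \<Longrightarrow> y \<in> set ys \<Longrightarrow> y < x"
  shows "heights m (xs @ N # ys) =
    map Suc (heights m xs) @ (if xs = [] \<and> N < m then [0] else []) @ heights N ys"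
  using assms
proof (induction xs arbitrary: m)
  case Nil
  have "heights m ys = heights N ys"
    using Nil.prems(2) by (cases ys) auto
  moreover have "filter ((<) N) ys = []"
    using Nil.prems(2) by (fastforce simp: filter_empty_conv)
  ultimately show ?case
    by simp
next
  case (Cons x xs)
  then have x: "x < N" "\<And>y. y \<in> set ys \<Longrightarrow> y < x"
    by auto
  then have "filter ((<) x) ys = []"
    by (auto simp: filter_empty_conv dest: less_asym)
  with Cons x show ?case
    by auto
qed

lemma heights_map_add: "heights (m + r) (map (\<lambda>x. x + r) p) = heights m p"
  by (induction p arbitrary: m) (auto simp: filter_map comp_def)

lemma heights_glue:
  assumes "L \<in> Sym l" "R \<in> Sym r"
  shows "heights (Suc (Suc (l + r))) (glue L R) =
    map Suc (heights (Suc l) L) @ (if l = 0 then [0] else []) @ heights (Suc r) R"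
proof -
  have len: "length L = l" "length R = r"
    using assms length_Sym by auto
  have L: "0 < x" "x \<le> l" if "x \<in> set L" for x
    using that assms by (auto simp: in_Sym_iff)
  have R: "0 < x" "x \<le> r" if "x \<in> set R" for x
    using that assms by (auto simp: in_Sym_iff)
  \<comment> \<open>Any bound above all entries gives the same heights, as the first entry is then a
    minimum.\<close>
  have top: "heights m (map (\<lambda>x. x + r) L) = heights (Suc l + r) (map (\<lambda>x. x + r) L)"
    if "l + r < m" for m
    using that L by (cases L) force+
  have "heights (Suc (l + r)) R = heights (Suc r) R"
    using R by (cases R) force+
  moreover have "heights (Suc (Suc (l + r))) (map (\<lambda>x. x + r) L) = heights (Suc l) L"
    by (subst top) (simp_all only: heights_map_add)
  moreover have "l = 0 \<longleftrightarrow> L = []"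
    using len by auto
  moreover have split: "heights (Suc (Suc (l + r))) (map (\<lambda>x. x + r) L @ Suc (l + r) # R) =
      map Suc (heights (Suc (Suc (l + r))) (map (\<lambda>x. x + r) L)) @
      (if map (\<lambda>x. x + r) L = [] \<and> Suc (l + r) < Suc (Suc (l + r)) then [0] else []) @
      heights (Suc (l + r)) R"
  proof (rule heights_append_max)
    fix y assume "y \<in> set R"
    then show "y < Suc (l + r) \<and> y < Suc (Suc (l + r))"
      using R(2)[of y] by simp
  next
    fix x assume "x \<in> set (map (\<lambda>x. x + r) L)"
    then show "x < Suc (l + r)"
      using L(2) by fastforce
  next
    fix x y assume "x \<in> set (map (\<lambda>x. x + r) L)" "y \<in> set R"
    then show "y < x"
      using L(1) R(2)[of y] by fastforce
  qed
  ultimately show ?thesis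
    by (simp add: glue_def len split)
qed

lemma glue_Sym:
  assumes "L \<in> Sym l" "R \<in> Sym r"
  shows "glue L R \<in> Sym (Suc (l + r))"
proof -
  have len: "length L = l" "length R = r"
    using assms length_Sym by auto
  have "(\<lambda>x. x + r) ` {1..l} = {1 + r..l + r}"
    by (rule image_add_atLeastAtMost')
  then show ?thesis
    using assms by (auto simp: in_Sym_iff glue_def len distinct_map)
qed

lemma lower_part_eq_atLeastAtMost:
  fixes A B :: "nat set"
  assumes "A \<union> B = {1..n}" "\<And>a b. a \<in> A \<Longrightarrow> b \<in> B \<Longrightarrow> b < a"
  shows "B = {1..card B}"
proof (cases "B = {}")
  case False
  have fin: "finite B"
    using assms(1) by (metis finite_Un finite_atLeastAtMost)
  have "B = {1..Max B}"
  proof (intro equalityI subsetI)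
    fix x assume "x \<in> B"
    then show "x \<in> {1..Max B}"
      using assms(1) fin by auto
  next
    fix x assume x: "x \<in> {1..Max B}"
    have "Max B \<in> B"
      using fin False by simp
    then have "Max B \<in> {1..n}"
      using assms(1) by blast
    then have "x \<in> A \<union> B"
      unfolding assms(1) using x by simp
    moreover have "x \<notin> A"
      using assms(2)[OF _ \<open>Max B \<in> B\<close>, of x] x by auto
    ultimately show "x \<in> B"
      by simp
  qed
  then show ?thesis
    by (metis card_atLeastAtMost diff_Suc_1)
qed simp

lemma Sym_132_unglue:
  assumes "p \<in> Av (Suc n) [1, 3, 2]"
  obtains l L R where "l \<le> n" "L \<in> Sym l" "R \<in> Sym (n - l)" "p = glue L R"
proof -
  have p: "distinct p" "set p = {1..Suc n}" "length p = Suc n"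
    using assms length_Sym by (auto simp: in_Av_132_iff in_Sym_iff simp del: One_nat_def)
  then have "Suc n \<in> set p"
    by simp
  then obtain L' R where p_eq: "p = L' @ Suc n # R"
    by (meson split_list)
  have "distinct (L' @ Suc n # R)" "set (L' @ Suc n # R) = {1..Suc n}"
    using p p_eq by simp_all
  then have dist: "distinct L'" "distinct R" "set L' \<inter> set R = {}"
    and "set L' \<union> set R = {1..Suc n} - {Suc n}"
    by auto
  moreover have "{1..Suc n} - {Suc n} = {1..n}"
    by auto
  ultimately have sets: "set L' \<union> set R = {1..n}"
    by simp
  \<comment> \<open>Otherwise \<open>x\<close>, \<open>Suc n\<close>, \<open>y\<close> would form a
    132.\<close>
  have less: "y < x" if xy: "x \<in> set L'" "y \<in> set R" for x y
  proof (rule ccontr)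
    assume "\<not> y < x"
    moreover have "x \<noteq> y" "y \<le> n"
      using dist sets xy by auto
    ultimately have "x < y" "y < Suc n"
      by auto
    obtain us vs where "L' = us @ x # vs"
      using xy(1) by (meson split_list)
    then have "avoids_above (>) (us @ x # vs @ Suc n # R)"
      using assms by (simp add: in_Av_132_iff p_eq del: One_nat_def)
    then have "avoids_above (>) (x # vs @ Suc n # R)"
      by (induction us) auto
    with \<open>x < y\<close> \<open>y < Suc n\<close> show False
      using xy(2) by (auto simp: sorted_wrt_append)
  qed
  define l r where "l = length L'" and "r = length R"
  have n: "n = l + r"
    using p(3) by (simp add: p_eq l_def r_def)
  have "set R = {1..card (set R)}"
    using sets less by (rule lower_part_eq_atLeastAtMost)
  then have R: "set R = {1..r}"
    using dist by (simp add: distinct_card r_def)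
  have "set L' = {1..n} - set R"
    using sets dist by auto
  then have L': "set L' = {Suc r..l + r}"
    using R n by auto
  \<comment> \<open>All entries of \<open>L'\<close> exceed \<open>r\<close>, so the subtraction is
    exact and adding \<open>r\<close> undoes it.\<close>
  define L where "L = map (\<lambda>x. x - r) L'"
  have "distinct L"
    using dist L' by (auto simp: L_def distinct_map inj_on_def)
  moreover have "set L \<subseteq> {1..l}"
    using L' by (auto simp: L_def)
  moreover have "card (set L) = l"
    using distinct_card[OF \<open>distinct L\<close>] by (simp only: L_def l_def length_map)
  ultimately have "L \<in> Sym l"
    unfolding in_Sym_iff by (metis card_atLeastAtMost card_subset_eq diff_Suc_1 finite_atLeastAtMost)
  moreover have "R \<in> Sym (n - l)"
    using R n dist by (simp add: in_Sym_iff)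
  moreover have "map (\<lambda>x. x + r) L = L'"
    using L' by (auto simp: L_def intro!: map_idI)
  then have "p = glue L R"
    unfolding glue_def p_eq by (simp add: n r_def l_def L_def)
  ultimately show ?thesis
    using that[of l L R] n by simp
qed

text \<open>As the numbers of 132s add up, a glued list avoids 132 iff both parts do; surjectivity
  is \<open>Sym_132_unglue\<close>.\<close>

lemma bij_betw_glue:
  "bij_betw (\<lambda>(l, L, R). glue L R)
     (SIGMA l:{..n}. Av l [1, 3, 2] \<times> Av (n - l) [1, 3, 2]) (Av (Suc n) [1, 3, 2])"
  unfolding bij_betw_def
proof (intro conjI equalityI subsetI)
  show "inj_on (\<lambda>(l, L, R). glue L R) (SIGMA l:{..n}. Av l [1, 3, 2] \<times> Av (n - l) [1, 3, 2])"
  proof (rule inj_onI)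
    fix u v
    assume "u \<in> (SIGMA l:{..n}. Av l [1, 3, 2] \<times> Av (n - l) [1, 3, 2])"
      and "v \<in> (SIGMA l:{..n}. Av l [1, 3, 2] \<times> Av (n - l) [1, 3, 2])"
      and uv: "(case u of (l, L, R) \<Rightarrow> glue L R) = (case v of (l, L, R) \<Rightarrow> glue L R)"
    then obtain l L R l' L' R' where u: "u = (l, L, R)" and v: "v = (l', L', R')"
      and "l \<le> n" "l' \<le> n" and mem: "L \<in> Av l [1, 3, 2]" "R \<in> Av (n - l) [1, 3, 2]"
        "L' \<in> Av l' [1, 3, 2]" "R' \<in> Av (n - l') [1, 3, 2]"
      by (elim SigmaE) simp
    have eq: "glue L R = glue L' R'"
      using uv by (simp add: u v)
    from mem have len: "length L = l" "length R = n - l" "length L' = l'" "length R' = n - l'"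
      using length_Sym by (auto simp: Av_def)
    have less: "x < Suc n" if "x \<in> set (map (\<lambda>x. x + length R) L) \<union> set R" for x
      using that mem len \<open>l \<le> n\<close> by (auto simp: Av_def in_Sym_iff)
    have eq': "map (\<lambda>x. x + length R) L @ Suc n # R = map (\<lambda>x. x + length R') L' @ Suc n # R'"
      using eq len \<open>l \<le> n\<close> \<open>l' \<le> n\<close> by (simp add: glue_def)
    \<comment> \<open>The maximum occurs only once, so it marks the same cut in both lists.\<close>
    have notin: "Suc n \<notin> set (map (\<lambda>x. x + length R) L)" "Suc n \<notin> set R"
      using less[of "Suc n"] by auto
    have "map (\<lambda>x. x + length R) L = map (\<lambda>x. x + length R') L' \<and> R = R'"
      by (rule iffD1[OF append_Cons_eq_iff[OF notin] eq'])
    then have maps: "map (\<lambda>x. x + length R) L = map (\<lambda>x. x + length R') L'" and "R = R'"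
      by - (erule conjE, assumption)+
    have "inj (\<lambda>x. x + length R')"
      by (auto simp: inj_on_def)
    then have "L = L'"
      using maps unfolding \<open>R = R'\<close> by (simp only: inj_map_eq_map)
    with \<open>R = R'\<close> len show "u = v"
      by (simp add: u v)
  qed
next
  fix p assume "p \<in> (\<lambda>(l, L, R). glue L R) ` (SIGMA l:{..n}. Av l [1, 3, 2] \<times> Av (n - l) [1, 3, 2])"
  then obtain l L R where *: "p = glue L R" "l \<le> n" "L \<in> Av l [1, 3, 2]" "R \<in> Av (n - l) [1, 3, 2]"
    by auto
  then show "p \<in> Av (Suc n) [1, 3, 2]"
    using glue_Sym[of L l R "n - l"] num_occ_132_glue[of L l R "n - l"]
    by (simp add: Av_def avoids_def del: One_nat_def)
next
  fix p assume p: "p \<in> Av (Suc n) [1, 3, 2]"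
  then obtain l L R where *: "l \<le> n" "L \<in> Sym l" "R \<in> Sym (n - l)" "p = glue L R"
    by (rule Sym_132_unglue)
  then have "L \<in> Av l [1, 3, 2]" "R \<in> Av (n - l) [1, 3, 2]"
    using p num_occ_132_glue[OF *(2,3)] by (simp_all add: Av_def avoids_def del: One_nat_def)
  with * show "p \<in> (\<lambda>(l, L, R). glue L R) `
      (SIGMA l:{..n}. Av l [1, 3, 2] \<times> Av (n - l) [1, 3, 2])"
    by (auto intro!: image_eqI[where x = "(l, L, R)"] simp del: One_nat_def)
qed

lemma sum_Av_132_Suc:
  "(\<Sum>p\<in>Av (Suc n) [1, 3, 2]. g p) =
    (\<Sum>l\<le>n. \<Sum>L\<in>Av l [1, 3, 2]. \<Sum>R\<in>Av (n - l) [1, 3, 2]. g (glue L R))"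
  using sum.reindex_bij_betw[OF bij_betw_glue, of g n, symmetric]
  by (simp add: sum.Sigma finite_Av case_prod_unfold sum.cartesian_product del: One_nat_def)

section \<open>Generating functions over 132-avoiders\<close>

definition gf :: "(nat list \<Rightarrow> int) \<Rightarrow> int fps" where
  "gf g = Abs_fps (\<lambda>n. \<Sum>p\<in>Av n [1, 3, 2]. g p)"

text \<open>Products of statistics of the two parts become products of series, and the factor
  \<open>fps_X\<close> accounts for the maximum. The list \<open>ts\<close> lets one lemma serve all
  statistics.\<close>

lemma gf_glue:
  assumes "\<And>l r L R. L \<in> Sym l \<Longrightarrow> R \<in> Sym r \<Longrightarrow> g (glue L R) = (\<Sum>(a, b)\<leftarrow>ts. a L * b R)"
  shows "gf g = fps_const (g []) + fps_X * (\<Sum>(a, b)\<leftarrow>ts. gf a * gf b)"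
proof (rule fps_ext)
  fix n
  show "gf g $ n = (fps_const (g []) + fps_X * (\<Sum>(a, b)\<leftarrow>ts. gf a * gf b)) $ n"
  proof (cases n)
    case 0
    have "Av 0 [1, 3, 2] = {[]}"
      by (auto simp: in_Av_132_iff Sym_def simp del: One_nat_def)
    then show ?thesis
      using 0 by (simp add: gf_def)
  next
    case (Suc k)
    have "gf g $ n = (\<Sum>l\<le>k. \<Sum>L\<in>Av l [1, 3, 2]. \<Sum>R\<in>Av (k - l) [1, 3, 2].
        \<Sum>(a, b)\<leftarrow>ts. a L * b R)"
      unfolding gf_def Suc fps_nth_Abs_fps sum_Av_132_Suc
      by (intro sum.cong refl assms) (auto simp: Av_def)
    also have "\<dots> = (\<Sum>(a, b)\<leftarrow>ts. gf a * gf b) $ k"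
    proof (induction ts)
      case (Cons ab ts)
      obtain a b where "ab = (a, b)"
        by fastforce
      then show ?case
        using Cons by (simp add: sum.distrib fps_mult_nth gf_def sum_product atLeast0AtMost
            del: One_nat_def)
    qed simp
    finally show ?thesis
      using Suc by simp
  qed
qed

text \<open>The operator \<open>fps_X * fps_deriv\<close> multiplies the coefficient at
  \<open>n\<close> by \<open>n\<close>, the common length of the lists in
  \<open>Av n\<close>.\<close>

lemma gf_length: "gf (\<lambda>p. int (length p) * g p) = fps_X * fps_deriv (gf g)"
proof (rule fps_ext)
  fix n
  have "gf (\<lambda>p. int (length p) * g p) $ n = (\<Sum>p\<in>Av n [1, 3, 2]. int n * g p)"
    unfolding gf_def fps_nth_Abs_fps by (intro sum.cong) (auto simp: Av_def length_Sym)
  also have "\<dots> = (fps_X * fps_deriv (gf g)) $ n"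
    by (cases n) (simp_all add: gf_def sum_distrib_left Suc_eq_plus1 add.commute del: One_nat_def)
  finally show "gf (\<lambda>p. int (length p) * g p) $ n = (fps_X * fps_deriv (gf g)) $ n" .
qed


text \<open>
  With \<open>t = X C\<close> and \<open>s = 1 - 2 t\<close> (that is, \<open>s\<^sup>2 = 1 - 4 X\<close>) the series are \<open>U = t\<^sup>2 / s\<^sup>2\<close>, \<open>V = t\<^sup>2 / s\<^sup>3\<close>
  and \<open>F = t\<^sup>3 / s\<^sup>4\<close>; denominators are cleared below.
\<close>

lemma fps_occurrence_identity:
  fixes X C M U V A F N :: "int fps"
  assumes X: "fps_deriv X = 1" "X $ 0 = 0"
   and C: "C = 1 + X * (C * C)"
   and M: "M = X * (M * C + (C * M + C))"
   and U: "U = X * (U * C + (M * C + C * U))"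
   and V: "V = X * (V * C + (U * C + (U * C + (M * C + C * V))))"
   and A: "A = X * (A * C + (C * A + N * C))"
   and F: "F = X * (F * C + (C * F + (N * N + A * N)))"
   and N: "N = X * fps_deriv C"
  shows "2 * F = X * fps_deriv U - 2 * V"
proof -
  define t s where "t = X * C" and "s = 1 - 2 * t"
  \<comment> \<open>Multiplying the equation for \<open>C\<close> by \<open>X\<close> gives
    \<open>t = X + t * t\<close>.\<close>
  have Xt: "X = t - t * t"
    unfolding t_def using C by algebra
  have Ct: "C * (1 - t) = 1"
    unfolding t_def using C by algebra
  have "1 = fps_deriv t - (t * fps_deriv t + fps_deriv t * t)"
    using arg_cong[OF Xt, of fps_deriv] X(1) by simp
  then have dt: "fps_deriv t * s = 1"
    unfolding s_def by algebra
  have Ms: "M * s = t"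
    unfolding s_def t_def using M by algebra
  have Us: "U * s ^ 2 = t ^ 2"
  proof -
    have "U * s = t * M"
      unfolding s_def t_def using U by algebra
    then have "U * s ^ 2 = t * (M * s)"
      by (simp add: power2_eq_square mult_ac)
    then show ?thesis
      by (simp add: Ms power2_eq_square)
  qed
  have Vs: "V * s ^ 3 = t ^ 2"
  proof -
    have "V * s = t * (2 * U + M)"
      unfolding s_def t_def using V by algebra
    moreover have "V * s ^ 3 = (V * s) * s ^ 2"
      by (simp add: power2_eq_square power3_eq_cube mult_ac)
    ultimately have "V * s ^ 3 = t * (2 * (U * s ^ 2) + (M * s) * s)"
      by (simp add: power2_eq_square algebra_simps)
    then have "V * s ^ 3 = t ^ 2 * (2 * t + s)"
      unfolding Us Ms by (simp add: power2_eq_square algebra_simps)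
    then show ?thesis by (simp add: s_def)
  qed
  \<comment> \<open>This says \<open>fps_deriv C * s = C * C\<close>; multiplication by
    \<open>X\<close> gives \<open>N\<close>.\<close>
  have "fps_deriv C = X * (C * fps_deriv C + fps_deriv C * C) + C * C"
    using arg_cong[OF C, of fps_deriv] X(1) by simp
  then have Ns: "N * s = t * C"
    unfolding N s_def t_def by algebra
  have As: "A * s ^ 2 = t ^ 2 * C"
  proof -
    have "A * s = t * N"
      unfolding s_def t_def using A by algebra
    then have "A * s ^ 2 = t * (N * s)"
      by (simp add: power2_eq_square mult_ac)
    then show ?thesis
      by (simp add: Ns power2_eq_square mult_ac)
  qed
  have Fs: "F * s ^ 4 = t ^ 3"
  proof -
    have "F * s = X * N * (N + A)"
      unfolding s_def t_def using F by algebra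
    then have "F * s ^ 4 = X * (N * s) * ((N * s) * s + A * s ^ 2)" by algebra
    also have "\<dots> = X * (t * C) * (t * C * s + t ^ 2 * C)"
      by (simp only: Ns As)
    \<comment> \<open>\<open>X * C = t\<close> and \<open>s + t = 1 - t\<close>.\<close>
    also have "\<dots> = t ^ 3 * (C * (1 - t))"
      unfolding s_def using t_def by algebra
    finally show ?thesis by (simp add: Ct)
  qed
  \<comment> \<open>\<open>U * s ^ 2 = t ^ 2\<close> is differentiated, with
    \<open>- 2 * fps_deriv t\<close> as the derivative of \<open>s\<close>. Multiplying by
    \<open>s ^ 2\<close> afterwards makes \<open>fps_deriv t * s = 1\<close> applicable.\<close>
  have "fps_deriv U * s * s - 4 * (U * s * fps_deriv t) = 2 * (t * fps_deriv t)"
    using arg_cong[OF Us, of fps_deriv]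
    by (simp add: s_def power2_eq_square algebra_simps)
  then have "fps_deriv U * s ^ 4 - 4 * (U * s ^ 2 * (fps_deriv t * s)) = 2 * (t * s * (fps_deriv t * s))"
    by algebra
  then have "fps_deriv U * s ^ 4 = 2 * t"
    unfolding Us dt by (simp add: s_def power2_eq_square algebra_simps)
  then have "(X * fps_deriv U - 2 * V) * s ^ 4 = X * (2 * t) - 2 * (V * s ^ 3) * s"
    by (simp add: algebra_simps power_numeral_reduce)
  also have "\<dots> = (t - t * t) * (2 * t) - 2 * t ^ 2 * (1 - 2 * t)"
    unfolding Vs by (simp only: Xt[symmetric] s_def mult.assoc)
  also have "\<dots> = 2 * (F * s ^ 4)"
    unfolding Fs by (simp add: algebra_simps power_numeral_reduce)
  finally have "(2 * F) * s ^ 4 = (X * fps_deriv U - 2 * V) * s ^ 4"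
    by (simp only: mult.assoc)
  \<comment> \<open>The constant coefficient of \<open>s\<close> is 1, so \<open>s ^ 4\<close> is
    nonzero and cancels in the integral domain of integer series.\<close>
  moreover have "s $ 0 = 1"
    using X(2) by (simp add: s_def t_def numeral_fps_const)
  then have "s ^ 4 \<noteq> 0"
    by auto
  ultimately show ?thesis
    by simp
qed

section \<open>Series equations for the statistics of 132-avoiders\<close>

lemma gf_231:
  "2 * gf (\<lambda>p. int (num_occ [2, 3, 1] p)) =
    gf (\<lambda>p. int (length p) * int (sum_list (heights (Suc (length p)) p)))
    - 2 * gf (\<lambda>p. int (\<Sum>u\<leftarrow>heights (Suc (length p)) p. u * u))"
proof -
  define hs where "hs p = heights (Suc (length p)) p" for p
  define one len cnt sm sq asc occ :: "nat list \<Rightarrow> int"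
    where "one = (\<lambda>p. 1)" and "len = (\<lambda>p. int (length p))"
      and "cnt = (\<lambda>p. int (length (hs p)))" and "sm = (\<lambda>p. int (sum_list (hs p)))"
      and "sq = (\<lambda>p. int (\<Sum>u\<leftarrow>hs p. u * u))"
      and "asc = (\<lambda>p. int (pair_sum (\<lambda>x y. of_bool (x < y)) p))"
      and "occ = (\<lambda>p. int (num_occ [2, 3, 1] p))"
  note defs = one_def len_def cnt_def sm_def sq_def asc_def occ_def
  have hs_glue: "hs (glue L R) = map Suc (hs L) @ (if length L = 0 then [0] else []) @ hs R"
    if "L \<in> Sym l" "R \<in> Sym r" for L R l r
    using heights_glue[OF that] that by (simp add: hs_def length_glue length_Sym)
  have sum_Suc: "(\<Sum>u\<leftarrow>us. Suc u) = sum_list us + length us" for us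
    by (induction us) auto
  have sum_Suc_square: "(\<Sum>u\<leftarrow>us. Suc u * Suc u) = (\<Sum>u\<leftarrow>us. u * u) + 2 * sum_list us + length us"
    for us
    by (induction us) auto
  \<comment> \<open>Marks an empty left part, the case in which the maximum is itself a minimum of
    height 0.\<close>
  define empty :: "nat list \<Rightarrow> int" where "empty = (\<lambda>p. of_bool (p = []))"
  define X C :: "int fps"
    where "X = fps_X" and "C = gf one"
  have nil: "num_occ [2, 3, 1] [] = 0"
    unfolding num_occ_231 by simp
  have "C = 1 + X * (C * C)"
    using gf_glue[of one "[(one, one)]"] by (simp add: defs C_def X_def)
  have empty: "gf empty = 1"
    using gf_glue[of empty "[]"] by (simp add: empty_def glue_def)
  have "gf cnt = X * (gf cnt * C + (C * gf cnt + gf empty * C))"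
    using gf_glue[of cnt "[(cnt, one), (one, cnt), (empty, one)]"]
    by (simp add: defs C_def X_def hs_glue) (simp add: hs_def empty_def)
  then have "gf cnt = X * (gf cnt * C + (C * gf cnt + C))"
    by (simp only: empty mult_1)
  have "gf sm = X * (gf sm * C + (gf cnt * C + C * gf sm))"
    using gf_glue[of sm "[(sm, one), (cnt, one), (one, sm)]"]
    by (simp add: defs C_def X_def hs_glue sum_Suc) (simp add: hs_def)
  \<comment> \<open>From \<open>(u + 1) ^ 2 = u ^ 2 + 2 * u + 1\<close>: the repeated pair
    \<open>(sm, one)\<close> stands for the coefficient 2.\<close>
  have "gf sq = X * (gf sq * C + (gf sm * C + (gf sm * C + (gf cnt * C + C * gf sq))))"
    using gf_glue[of sq "[(sq, one), (sm, one), (sm, one), (cnt, one), (one, sq)]"]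
    by (simp add: defs C_def X_def hs_glue sum_Suc_square comp_def del: mult_Suc mult_Suc_right)
      (simp add: hs_def)
  have "gf asc = X * (gf asc * C + (C * gf asc + gf len * C))"
    using gf_glue[of asc "[(asc, one), (one, asc), (len, one)]"]
    by (simp add: defs C_def X_def pair_sum_glue length_Sym)
  have "gf occ = X * (gf occ * C + (C * gf occ + (gf len * gf len + gf asc * gf len)))"
    using gf_glue[of occ "[(occ, one), (one, occ), (len, len), (asc, len)]"]
    by (simp add: defs C_def X_def num_occ_231_glue length_Sym nil del: One_nat_def)
  have "gf len = X * fps_deriv C"
    using gf_length[of one] by (simp add: defs C_def X_def)
  \<comment> \<open>In the identity, \<open>M\<close>, \<open>U\<close>, \<open>V\<close>,
    \<open>A\<close>, \<open>N\<close> belong to the number of minima, the sum of heights, the sum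
    of their squares, the ascents and the length, and \<open>F\<close> to the count of 231.\<close>
  have "2 * gf occ = X * fps_deriv (gf sm) - 2 * gf sq"
    by (rule fps_occurrence_identity[of X C "gf cnt" "gf sm" "gf sq" "gf asc" "gf len"])
      (fact | simp add: X_def; fail)+
  then show ?thesis
    unfolding X_def gf_length[symmetric] by (simp only: occ_def sm_def sq_def hs_def)
qed

theorem corollary21:
  fixes n :: nat
  assumes "n \<ge> 1"
  shows "total_occ [2, 3, 1] (Av n [1, 2, 3]) = total_occ [2, 3, 1] (Av n [1, 3, 2])"
proof -
  \<comment> \<open>The summand depends on \<open>p\<close> only through its heights, so the sum can
    be moved to the 132-avoiders.\<close>
  have "2 * int (total_occ [2, 3, 1] (Av n [1, 2, 3])) =
      (\<Sum>p\<in>Av n [1, 3, 2]. int n * int (sum_list (heights (Suc n) p))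
        - 2 * int (\<Sum>u\<leftarrow>heights (Suc n) p. u * u))"
    unfolding total_occ_231_Av_123 by (rule sum_heights_Av)
  also have "\<dots> = (\<Sum>p\<in>Av n [1, 3, 2]. int (length p) * int (sum_list (heights (Suc (length p)) p))
        - 2 * int (\<Sum>u\<leftarrow>heights (Suc (length p)) p. u * u))"
  proof (intro sum.cong refl)
    fix p assume "p \<in> Av n [1, 3, 2]"
    then have "length p = n"
      by (simp add: Av_def length_Sym)
    then show "int n * int (sum_list (heights (Suc n) p))
        - 2 * int (\<Sum>u\<leftarrow>heights (Suc n) p. u * u)
      = int (length p) * int (sum_list (heights (Suc (length p)) p))
        - 2 * int (\<Sum>u\<leftarrow>heights (Suc (length p)) p. u * u)"
      by (simp only:)
  qed
  also have "\<dots> = (gf (\<lambda>p. int (length p) * int (sum_list (heights (Suc (length p)) p)))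
    - 2 * gf (\<lambda>p. int (\<Sum>u\<leftarrow>heights (Suc (length p)) p. u * u))) $ n"
    by (simp add: gf_def sum_subtractf sum_distrib_left numeral_fps_const del: One_nat_def)
  also have "\<dots> = 2 * int (total_occ [2, 3, 1] (Av n [1, 3, 2]))"
    unfolding gf_231[symmetric] by (simp add: gf_def total_occ_def numeral_fps_const del: One_nat_def)
  finally show ?thesis
    by simp
qed

end
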